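(* Let $\mu>0$, $h>0$, $\lambda=-\frac{10}{9}h$ and $V_0=\frac{9\mu^4}{10h}$. For $Q\in\mathfrak h_0(5)$ define $$V_B(Q):=\begin{cases} \displaystyle V\left(\frac{\delta}{d_B}\Phi_B^-+\left(1-\frac{\delta}{d_B}\right)\Phi_B^+\right), & d(Q,\Sigma_B^+)=\delta<d_B/2,\\[6pt] \displaystyle V\left(\frac{\delta}{d_B}\Phi_B^++\left(1-\frac{\delta}{d_B}\right)\Phi_B^-\right), & d(Q,\Sigma_B^-)=\delta<d_B/2,\\[6pt] 0, & d(Q,\Sigma_B^+)\ge d_B/2\text{ and }d(Q,\Sigma_B^-)\ge d_B/2 . \end{cases}$$ Then $V(Q)\ge V_B(Q)$ for every $Q\in\mathfrak h_0(5)$.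
   Context: Let $\mathfrak h_0(5)=\{Q\in\mathbb C^{5\times5}:Q^\dagger=Q,\ \operatorname{Tr}Q=0\}$ with norm $\lVert A\rVert_F=(\operatorname{Tr}(A^2))^{1/2}$. The potential is $$V(\Phi)=-\mu^2\operatorname{Tr}(\Phi^2)+h\bigl(\operatorname{Tr}(\Phi^2)\bigr)^2+\lambda\operatorname{Tr}(\Phi^4)+V_0,\qquad\Phi\in\mathfrak h_0(5).$$ Set $v=\frac{3\mu}{10\sqrt h}$, $\Phi_B^+=v\operatorname{diag}(1,1,1,1,-4)$, $\Phi_B^-=v\operatorname{diag}(-1,-1,-1,4,-1)$, and $\Sigma_B^\pm=\{U^\dagger\Phi_B^\pm U:U\in\operatorname{SU}(5)\}$. For a nonempty compact $S\subset\mathfrak h_0(5)$, $d(Q,S)=\min_{P\in S}\lVert Q-P\rVert_F$, and $d_B=\min\{\lVert P-Q\rVert_F:P\in\Sigma_B^-,\,Q\in\Sigma_B^+\}=\sqrt{30}\,v$; the first two cases in the definition of $V_B$ cannot overlap because of the triangle inequality. *)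

theory Defs
  imports "HOL-Analysis.Analysis"
begin

text \<open>
  On the type \<^typ>\<open>complex^'n^'n\<close> the class operations \<open>*\<close> and \<open>^\<close> act componentwise, so
  matrix products are written with \<open>**\<close> throughout.
\<close>

definition adjoint_mat :: "complex^'n^'n \<Rightarrow> complex^'n^'n"
  where "adjoint_mat A = (\<chi> i j. cnj (A $ j $ i))"

definition diag_matrix :: "complex^'n \<Rightarrow> complex^'n^'n"
  where "diag_matrix x = (\<chi> i j. if i = j then x $ i else 0)"

definition herm0 :: "(complex^5^5) set"
  where "herm0 = {Q. adjoint_mat Q = Q \<and> trace Q = 0}"

definition SU5 :: "(complex^5^5) set"
  where "SU5 = {U. adjoint_mat U ** U = mat 1 \<and> U ** adjoint_mat U = mat 1 \<and> det U = 1}"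

text \<open>
  The traces of powers of a Hermitian matrix are real; \<^const>\<open>Re\<close> only changes the type.
\<close>

definition frob_norm :: "complex^5^5 \<Rightarrow> real"
  where "frob_norm A = sqrt (Re (trace (A ** A)))"

definition potential :: "real \<Rightarrow> real \<Rightarrow> real \<Rightarrow> real \<Rightarrow> complex^5^5 \<Rightarrow> real"
  where "potential \<mu> h lam V0 \<Phi> =
    - \<mu>\<^sup>2 * Re (trace (\<Phi> ** \<Phi>)) + h * (Re (trace (\<Phi> ** \<Phi>)))\<^sup>2
    + lam * Re (trace (\<Phi> ** \<Phi> ** \<Phi> ** \<Phi>)) + V0"

definition vev :: "real \<Rightarrow> real \<Rightarrow> real"
  where "vev \<mu> h = 3 * \<mu> / (10 * sqrt h)"

definition Phi_plus :: "real \<Rightarrow> real \<Rightarrow> complex^5^5"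
  where "Phi_plus \<mu> h = vev \<mu> h *\<^sub>R diag_matrix (vector [1, 1, 1, 1, -4])"

definition Phi_minus :: "real \<Rightarrow> real \<Rightarrow> complex^5^5"
  where "Phi_minus \<mu> h = vev \<mu> h *\<^sub>R diag_matrix (vector [-1, -1, -1, 4, -1])"

definition SU5_orbit :: "complex^5^5 \<Rightarrow> (complex^5^5) set"
  where "SU5_orbit \<Phi> = {adjoint_mat U ** \<Phi> ** U | U. U \<in> SU5}"

abbreviation Sigma_plus :: "real \<Rightarrow> real \<Rightarrow> (complex^5^5) set"
  where "Sigma_plus \<mu> h \<equiv> SU5_orbit (Phi_plus \<mu> h)"

abbreviation Sigma_minus :: "real \<Rightarrow> real \<Rightarrow> (complex^5^5) set"
  where "Sigma_minus \<mu> h \<equiv> SU5_orbit (Phi_minus \<mu> h)"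

text \<open>
  The two minima over (infinite, compact) orbits are written as infima; that they are attained
  is shown in \<open>dist_set_attained\<close> and \<open>dist_B_attained\<close> below.
\<close>

definition dist_set :: "complex^5^5 \<Rightarrow> (complex^5^5) set \<Rightarrow> real"
  where "dist_set Q S = (INF P\<in>S. frob_norm (Q - P))"

definition dist_B :: "real \<Rightarrow> real \<Rightarrow> real"
  where "dist_B \<mu> h = Inf {frob_norm (P - Q) | P Q. P \<in> Sigma_minus \<mu> h \<and> Q \<in> Sigma_plus \<mu> h}"

text \<open>
  The first two cases exclude each other (\<open>V_B_cases_disjoint\<close> below), so their order is
  immaterial.
\<close>

definition V_B :: "real \<Rightarrow> real \<Rightarrow> real \<Rightarrow> real \<Rightarrow> complex^5^5 \<Rightarrow> real"
  where "V_B \<mu> h lam V0 Q =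
    (let d = dist_B \<mu> h; dp = dist_set Q (Sigma_plus \<mu> h); dm = dist_set Q (Sigma_minus \<mu> h) in
     if dp < d / 2 then
       potential \<mu> h lam V0 ((dp / d) *\<^sub>R Phi_minus \<mu> h + (1 - dp / d) *\<^sub>R Phi_plus \<mu> h)
     else if dm < d / 2 then
       potential \<mu> h lam V0 ((dm / d) *\<^sub>R Phi_plus \<mu> h + (1 - dm / d) *\<^sub>R Phi_minus \<mu> h)
     else 0)"

lemma vector_5:
  "(vector [a, b, c, d, e] :: 'a::zero^5) $ 1 = a"
  "(vector [a, b, c, d, e] :: 'a::zero^5) $ 2 = b"
  "(vector [a, b, c, d, e] :: 'a::zero^5) $ 3 = c"
  "(vector [a, b, c, d, e] :: 'a::zero^5) $ 4 = d"
  "(vector [a, b, c, d, e] :: 'a::zero^5) $ 5 = e"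
  unfolding vector_def by simp_all

lemma adjoint_mat_mult: "adjoint_mat (A ** B) = adjoint_mat B ** adjoint_mat A"
  by (simp add: adjoint_mat_def matrix_matrix_mult_def vec_eq_iff mult.commute)

lemma adjoint_mat_diff: "adjoint_mat (A - B) = adjoint_mat A - adjoint_mat B"
  by (simp add: adjoint_mat_def vec_eq_iff)

lemma adjoint_mat_adjoint [simp]: "adjoint_mat (adjoint_mat A) = A"
  by (simp add: adjoint_mat_def vec_eq_iff)

lemma trace_real:
  assumes "adjoint_mat A = A"
  shows "Im (trace A) = 0"
proof -
  have "cnj (A $ i $ i) = A $ i $ i" for i
    using assms by (auto simp: adjoint_mat_def vec_eq_iff)
  then have "Im (A $ i $ i) = 0" for i
    by (metis Reals_cnj_iff complex_is_Real_iff)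
  then show ?thesis
    by (simp add: trace_def)
qed

lemma frob_norm_eq_norm:
  assumes "adjoint_mat A = A"
  shows "frob_norm A = norm A"
proof -
  have A: "A $ j $ i = cnj (A $ i $ j)" for i j
    using arg_cong[OF assms, of "\<lambda>B. B $ j $ i"] by (simp add: adjoint_mat_def)
  have "Re (trace (A ** A)) = (\<Sum>i\<in>UNIV. \<Sum>j\<in>UNIV. Re (A $ i $ j * A $ j $ i))"
    by (simp add: trace_def matrix_matrix_mult_def)
  also have "\<dots> = (\<Sum>i\<in>UNIV. \<Sum>j\<in>UNIV. (cmod (A $ i $ j))\<^sup>2)"
  proof (intro sum.cong refl)
    fix i j
    show "Re (A $ i $ j * A $ j $ i) = (cmod (A $ i $ j))\<^sup>2"
      unfolding A[of i j] by (simp add: cmod_power2 flip: power2_eq_square)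
  qed
  finally show ?thesis
    by (simp add: frob_norm_def norm_vec_def L2_set_def sum_nonneg)
qed

lemma exhaust_5:
  fixes x :: 5
  shows "x = 1 \<or> x = 2 \<or> x = 3 \<or> x = 4 \<or> x = 5"
proof (induct x)
  case (of_int z)
  then have "z = 0 \<or> z = 1 \<or> z = 2 \<or> z = 3 \<or> z = 4" by fastforce
  then show ?case by auto
qed

lemma forall_5: "(\<forall>i::5. P i) \<longleftrightarrow> P 1 \<and> P 2 \<and> P 3 \<and> P 4 \<and> P 5" (is "?L \<longleftrightarrow> ?R")
proof
  assume ?R
  then have "P i" for i
    by (rule_tac disjE[OF exhaust_5[of i]]) auto
  then show ?L ..
qed auto

lemma sum_5: "sum f (UNIV::5 set) = f 1 + f 2 + f 3 + f 4 + f 5"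
proof -
  have U: "(UNIV::5 set) = {1, 2, 3, 4, 5}"
    using exhaust_5 by auto
  show ?thesis
    unfolding U by (simp add: ac_simps)
qed

lemma adjoint_scaleR_diag:
  assumes "\<forall>i. cnj (x $ i) = x $ i"
  shows "adjoint_mat (r *\<^sub>R diag_matrix x) = r *\<^sub>R diag_matrix x"
  using assms by (auto simp: adjoint_mat_def diag_matrix_def vec_eq_iff)

lemma Phi_herm0: "Phi_plus \<mu> h \<in> herm0" "Phi_minus \<mu> h \<in> herm0"
proof -
  have "adjoint_mat (Phi_plus \<mu> h) = Phi_plus \<mu> h" "adjoint_mat (Phi_minus \<mu> h) = Phi_minus \<mu> h"
    unfolding Phi_plus_def Phi_minus_def
    by (rule adjoint_scaleR_diag, simp add: forall_5 vector_5)+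
  then show "Phi_plus \<mu> h \<in> herm0" "Phi_minus \<mu> h \<in> herm0"
    by (simp_all add: herm0_def trace_def sum_5 Phi_plus_def Phi_minus_def diag_matrix_def vector_5)
qed

lemma Phi_herm:
  "adjoint_mat (Phi_plus \<mu> h) = Phi_plus \<mu> h" "adjoint_mat (Phi_minus \<mu> h) = Phi_minus \<mu> h"
  using Phi_herm0 by (auto simp: herm0_def)

lemma SU5_orbit_herm:
  assumes "adjoint_mat \<Phi> = \<Phi>" "P \<in> SU5_orbit \<Phi>"
  shows "adjoint_mat P = P"
  using assms by (auto simp: SU5_orbit_def adjoint_mat_mult matrix_mul_assoc)

lemma SU5_orbit_nonempty: "SU5_orbit \<Phi> \<noteq> {}"
proof -
  have "adjoint_mat (mat 1 :: complex^5^5) = mat 1"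
    by (auto simp: adjoint_mat_def mat_def vec_eq_iff)
  then have "mat 1 \<in> SU5"
    by (simp add: SU5_def)
  then show ?thesis by (auto simp: SU5_orbit_def)
qed

lemma continuous_on_adjoint_mat [continuous_intros]:
  "continuous_on S f \<Longrightarrow> continuous_on S (\<lambda>x. adjoint_mat (f x))"
  unfolding adjoint_mat_def by (intro continuous_intros)

lemma continuous_on_cmat_mult [continuous_intros]:
  fixes f g :: "'a::topological_space \<Rightarrow> complex^'n^'n"
  shows "continuous_on S f \<Longrightarrow> continuous_on S g \<Longrightarrow> continuous_on S (\<lambda>x. f x ** g x)"
  unfolding matrix_matrix_mult_def by (intro continuous_intros)

lemma norm_SU5:
  assumes "U \<in> SU5"
  shows "(norm U)\<^sup>2 = 5"
proof -
  have "(norm U)\<^sup>2 = (\<Sum>i\<in>UNIV. \<Sum>j\<in>UNIV. (cmod (U $ i $ j))\<^sup>2)"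
    by (simp add: norm_vec_def L2_set_def sum_nonneg)
  also have "\<dots> = Re (trace (U ** adjoint_mat U))"
    by (simp add: trace_def matrix_matrix_mult_def adjoint_mat_def cmod_power2 flip: power2_eq_square)
  also have "\<dots> = 5"
    using assms by (simp add: SU5_def trace_I)
  finally show ?thesis .
qed

lemma compact_SU5: "compact SU5"
proof -
  have "closed SU5"
    unfolding SU5_def det_def
    by (intro closed_Collect_conj closed_Collect_eq continuous_intros)
  moreover have "bounded SU5"
    unfolding bounded_iff using norm_SU5 by (metis order_refl real_sqrt_unique norm_ge_zero)
  ultimately show ?thesis
    by (simp add: compact_eq_bounded_closed)
qed

lemma compact_SU5_orbit: "compact (SU5_orbit \<Phi>)"
proof -
  have eq: "SU5_orbit \<Phi> = (\<lambda>U. adjoint_mat U ** \<Phi> ** U) ` SU5"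
    by (auto simp: SU5_orbit_def)
  have cont: "continuous_on SU5 (\<lambda>U. adjoint_mat U ** \<Phi> ** U)"
    by (intro continuous_intros)
  show ?thesis
    unfolding eq by (rule compact_continuous_image[OF cont compact_SU5])
qed

lemma continuous_on_frob_norm [continuous_intros]:
  "continuous_on S f \<Longrightarrow> continuous_on S (\<lambda>x. frob_norm (f x))"
  unfolding frob_norm_def trace_def by (intro continuous_intros)

lemma dist_set_attained:
  assumes "compact S" "S \<noteq> {}"
  shows "\<exists>P\<in>S. dist_set Q S = frob_norm (Q - P) \<and> (\<forall>P'\<in>S. dist_set Q S \<le> frob_norm (Q - P'))"
proof -
  have "continuous_on S (\<lambda>P. frob_norm (Q - P))"
    by (intro continuous_intros)
  then obtain P where P: "P \<in> S" "\<And>P'. P' \<in> S \<Longrightarrow> frob_norm (Q - P) \<le> frob_norm (Q - P')"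
    using continuous_attains_inf[OF assms] by blast
  then have "dist_set Q S = frob_norm (Q - P)"
    unfolding dist_set_def by (intro cInf_eq_minimum) auto
  with P show ?thesis by auto
qed

lemma dist_B_attained:
  "\<exists>P\<in>Sigma_minus \<mu> h. \<exists>Q\<in>Sigma_plus \<mu> h. dist_B \<mu> h = frob_norm (P - Q) \<and>
     (\<forall>P'\<in>Sigma_minus \<mu> h. \<forall>Q'\<in>Sigma_plus \<mu> h. dist_B \<mu> h \<le> frob_norm (P' - Q'))"
proof -
  let ?S = "Sigma_minus \<mu> h \<times> Sigma_plus \<mu> h"
  have "compact ?S" "?S \<noteq> {}"
    by (auto simp: compact_Times compact_SU5_orbit SU5_orbit_nonempty)
  moreover have "continuous_on ?S (\<lambda>x. frob_norm (fst x - snd x))"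
    by (intro continuous_intros)
  ultimately obtain x where x: "x \<in> ?S"
    "\<And>y. y \<in> ?S \<Longrightarrow> frob_norm (fst x - snd x) \<le> frob_norm (fst y - snd y)"
    using continuous_attains_inf[of ?S "\<lambda>x. frob_norm (fst x - snd x)"] by blast
  obtain P Q where PQ: "x = (P, Q)" by fastforce
  have mem: "P \<in> Sigma_minus \<mu> h" "Q \<in> Sigma_plus \<mu> h"
    using x(1) PQ by auto
  have le: "frob_norm (P - Q) \<le> frob_norm (P' - Q')"
    if "P' \<in> Sigma_minus \<mu> h" "Q' \<in> Sigma_plus \<mu> h" for P' Q'
    using x(2)[of "(P', Q')"] that PQ by auto
  have "dist_B \<mu> h = frob_norm (P - Q)"
    unfolding dist_B_def by (intro cInf_eq_minimum) (use mem le in auto)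
  with mem le show ?thesis by auto
qed

lemma V_B_cases_disjoint:
  assumes "Q \<in> herm0"
    and "dist_set Q (Sigma_plus \<mu> h) < dist_B \<mu> h / 2"
    and "dist_set Q (Sigma_minus \<mu> h) < dist_B \<mu> h / 2"
  shows False
proof -
  obtain A where A: "A \<in> Sigma_plus \<mu> h" "dist_set Q (Sigma_plus \<mu> h) = frob_norm (Q - A)"
    using dist_set_attained[OF compact_SU5_orbit SU5_orbit_nonempty] by blast
  obtain B where B: "B \<in> Sigma_minus \<mu> h" "dist_set Q (Sigma_minus \<mu> h) = frob_norm (Q - B)"
    using dist_set_attained[OF compact_SU5_orbit SU5_orbit_nonempty] by blast
  have herm: "adjoint_mat Q = Q" "adjoint_mat A = A" "adjoint_mat B = B"
    using assms(1) SU5_orbit_herm[OF Phi_herm(1) A(1)] SU5_orbit_herm[OF Phi_herm(2) B(1)]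
    by (simp_all add: herm0_def)
  have "dist_B \<mu> h \<le> frob_norm (B - A)"
    using dist_B_attained A(1) B(1) by blast
  also have "\<dots> \<le> norm (Q - A) + norm (Q - B)"
    using norm_triangle_ineq4[of "Q - A" "Q - B"] by (simp add: frob_norm_eq_norm adjoint_mat_diff herm)
  also have "\<dots> < dist_B \<mu> h"
    using assms(2,3) A(2) B(2) by (simp add: frob_norm_eq_norm adjoint_mat_diff herm)
  finally show False by simp
qed

end

theory Submission
  imports Defs
begin

text \<open>
  Everything is expressed through the eigenvalues. A unitary maximizer of
  \<open>\<Sum>\<^sub>i d\<^sub>i (U Q U\<^sup>\<dagger>)\<^sub>i\<^sub>i\<close> with distinct weights \<open>d\<^sub>i\<close> diagonalizes \<open>Q\<close> and sorts its eigenvalues.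
  Since \<open>\<Phi>\<^sub>B\<^sup>+ = v (1 - 5 e e\<^sup>\<dagger>)\<close>, the squared distance of \<open>Q\<close> to \<open>\<Sigma>\<^sub>B\<^sup>+\<close> is \<open>Tr Q\<^sup>2 + 20 v\<^sup>2 + 10 v m\<close>
  with \<open>m\<close> the smallest eigenvalue, and in particular \<open>d\<^sub>B\<^sup>2 = 30 v\<^sup>2\<close>. For fixed \<open>Tr Q\<^sup>2\<close> and \<open>m = - 4 a v\<close>
  the other eigenvalues are \<open>v (a + y\<^sub>i)\<close> with \<open>\<Sum> y\<^sub>i = 0\<close>, and the sharp bounds on \<open>\<Sum> y\<^sub>i\<^sup>3\<close> and
  \<open>\<Sum> y\<^sub>i\<^sup>4\<close> are both attained at \<open>y \<propto> (-1, -1, -1, 3)\<close>, the direction of the segment. This leaves a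
  polynomial inequality in two real variables. Case \<open>\<Sigma>\<^sub>B\<^sup>-\<close> follows from \<open>\<Sigma>\<^sub>B\<^sup>- = - \<Sigma>\<^sub>B\<^sup>+\<close>.
\<close>

subsection \<open>Real inequalities\<close>

text \<open>The gap between the two sides is twice the discriminant of the monic cubic with roots
  \<open>a\<close>, \<open>b\<close>, \<open>c\<close>.\<close>

lemma sum_cube_sq_le_3:
  fixes a b c :: real
  assumes "a + b + c = 0"
  shows "6 * (a^3 + b^3 + c^3)\<^sup>2 \<le> (a\<^sup>2 + b\<^sup>2 + c\<^sup>2)^3"
proof -
  have c: "c = - a - b" using assms by simp
  have "(a\<^sup>2 + b\<^sup>2 + c\<^sup>2)^3 - 6 * (a^3 + b^3 + c^3)\<^sup>2 = 2 * ((a - b) * (b - c) * (c - a))\<^sup>2"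
    unfolding c by algebra
  moreover have "0 \<le> 2 * ((a - b) * (b - c) * (c - a))\<^sup>2" by simp
  ultimately show ?thesis by linarith
qed

text \<open>Split off \<open>d\<close>: \<open>k\<close> is the mean of the other three numbers and
  \<open>x\<close>, \<open>y\<close>, \<open>z\<close> are their deviations from it. The gap is then
  a quadratic in \<open>k\<close>; after multiplication by \<open>P\<close>, completing the square
  leaves \<open>P^3 - 6 * C^2\<close>, which the three-variable inequality controls. Equality for
  \<open>P = 0\<close> is the direction (-1, -1, -1, 3).\<close>

lemma power4_sum_le_4:
  fixes a b c d :: real
  assumes "a + b + c + d = 0"
  shows "12 * (a^4 + b^4 + c^4 + d^4) \<le> 7 * (a\<^sup>2 + b\<^sup>2 + c\<^sup>2 + d\<^sup>2)\<^sup>2"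
proof -
  define k where "k = - d / 3"
  define x y z where "x = a - k" and "y = b - k" and "z = c - k"
  define P C where "P = x\<^sup>2 + y\<^sup>2 + z\<^sup>2" and "C = x^3 + y^3 + z^3"
  have sum0: "x + y + z = 0"
    using assms by (simp add: x_def y_def z_def k_def)
  have z: "z = - x - y" using sum0 by simp
  have abcd: "a = x + k" "b = y + k" "c = z + k" "d = - 3 * k"
    by (simp_all add: x_def y_def z_def k_def)
  have eq: "7 * (a\<^sup>2 + b\<^sup>2 + c\<^sup>2 + d\<^sup>2)\<^sup>2 - 12 * (a^4 + b^4 + c^4 + d^4)
      = 96 * k\<^sup>2 * P - 48 * k * C + P\<^sup>2"
    unfolding abcd P_def C_def z by algebra
  have "0 \<le> P" by (simp add: P_def)
  have "0 \<le> 96 * k\<^sup>2 * P - 48 * k * C + P\<^sup>2"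
  proof (cases "P = 0")
    case True
    then have "x = 0" "y = 0" "z = 0"
      unfolding P_def by (smt (verit) zero_le_power2 power2_eq_iff_nonneg zero_power2 pos2 power_eq_0_iff)+
    then show ?thesis by (simp add: P_def C_def)
  next
    case False
    have "6 * C\<^sup>2 \<le> P^3"
      unfolding C_def P_def by (rule sum_cube_sq_le_3[OF sum0])
    moreover have "P * (96 * k\<^sup>2 * P - 48 * k * C + P\<^sup>2) = 6 * (4 * k * P - C)\<^sup>2 + (P^3 - 6 * C\<^sup>2)"
      by algebra
    ultimately have "0 \<le> P * (96 * k\<^sup>2 * P - 48 * k * C + P\<^sup>2)" by simp
    then show ?thesis using False \<open>0 \<le> P\<close> by (simp add: zero_le_mult_iff)
  qed
  with eq show ?thesis by simp
qed

text \<open>Cauchy-Schwarz for \<open>- a = b + c + d\<close>, with the gap written as squared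
  differences: a^2 is at most 3 (12 w^2 - a^2).\<close>

lemma component_le_4:
  fixes a b c d w :: real
  assumes "a + b + c + d = 0" "a\<^sup>2 + b\<^sup>2 + c\<^sup>2 + d\<^sup>2 = 12 * w\<^sup>2" "0 \<le> w"
  shows "a \<le> 3 * w"
proof -
  have a: "a = - b - c - d" using assms by simp
  have "3 * (b\<^sup>2 + c\<^sup>2 + d\<^sup>2) - a\<^sup>2 = (b - c)\<^sup>2 + (c - d)\<^sup>2 + (b - d)\<^sup>2"
    unfolding a by algebra
  moreover have "0 \<le> (b - c)\<^sup>2 + (c - d)\<^sup>2 + (b - d)\<^sup>2" by simp
  ultimately have "a\<^sup>2 \<le> 3 * (b\<^sup>2 + c\<^sup>2 + d\<^sup>2)" by linarith
  then have "a\<^sup>2 \<le> (3 * w)\<^sup>2"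
    using assms(2) by (simp add: power_mult_distrib)
  then show ?thesis
    by (rule power2_le_imp_le) (use assms(3) in simp)
qed

text \<open>Each \<open>x \<le> 3 w\<close> satisfies \<open>(x + w)\<^sup>2 (x - 3 w) \<le> 0\<close>; sum this over the four numbers.\<close>

lemma sum_cube_le_4:
  fixes a b c d w :: real
  assumes sum0: "a + b + c + d = 0" and sq: "a\<^sup>2 + b\<^sup>2 + c\<^sup>2 + d\<^sup>2 = 12 * w\<^sup>2" and w: "0 \<le> w"
  shows "a^3 + b^3 + c^3 + d^3 \<le> 24 * w^3"
proof -
  have le: "a \<le> 3 * w" "b \<le> 3 * w" "c \<le> 3 * w" "d \<le> 3 * w"
    using component_le_4[of a b c d w] component_le_4[of b a c d w]
      component_le_4[of c b a d w] component_le_4[of d b c a w] assms by (simp_all add: algebra_simps)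
  have "(x + w)\<^sup>2 * (x - 3 * w) \<le> 0" if "x \<le> 3 * w" for x
    using that by (intro mult_nonneg_nonpos) auto
  from this[OF le(1)] this[OF le(2)] this[OF le(3)] this[OF le(4)]
  have "(a + w)\<^sup>2 * (a - 3*w) + (b + w)\<^sup>2 * (b - 3*w) + (c + w)\<^sup>2 * (c - 3*w) + (d + w)\<^sup>2 * (d - 3*w) \<le> 0"
    by linarith
  also have "(a + w)\<^sup>2 * (a - 3*w) + (b + w)\<^sup>2 * (b - 3*w) + (c + w)\<^sup>2 * (c - 3*w) + (d + w)\<^sup>2 * (d - 3*w)
    = (a^3 + b^3 + c^3 + d^3) - w * (a\<^sup>2 + b\<^sup>2 + c\<^sup>2 + d\<^sup>2) - 5 * w\<^sup>2 * (a + b + c + d) - 12 * w^3"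
    by algebra
  finally show ?thesis
    unfolding sum0 sq by (simp add: power3_eq_cube power2_eq_square)
qed

text \<open>
  In units of the vacuum value, \<open>- 4 a\<close> is the smallest eigenvalue of \<open>\<Phi>\<close>, \<open>12 w\<^sup>2\<close> is the squared
  deviation of the other four from their mean \<open>a\<close>, and \<open>s\<close> is the distance to the orbit in units of
  \<open>d\<^sub>B\<close>. The segment from \<open>\<Phi>\<^sub>B\<^sup>+\<close> to \<open>\<Phi>\<^sub>B\<^sup>-\<close> is \<open>a = 1 - 3 s / 4\<close>, \<open>w = 5 s / 4\<close>; the
  coordinates \<open>\<alpha>\<close>, \<open>\<gamma>\<close> are chosen such that it becomes \<open>\<alpha> = s\<close>, \<open>\<gamma> = 0\<close>. The difference \<open>E\<close> of the two
  sides has no terms linear in \<open>\<gamma>\<close>, and \<open>s \<le> 1/2\<close> makes \<open>s E\<close> bounded below by a form homogeneous of degree 4.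
\<close>

lemma segment_ineq:
  fixes a w s :: real
  assumes w: "0 \<le> w" and s: "0 \<le> s" "s \<le> 1/2" and s2: "30 * s\<^sup>2 = 20 * (a - 1)\<^sup>2 + 12 * w\<^sup>2"
  shows "6000 * s\<^sup>2 * (1 - s)\<^sup>2
    \<le> 1000 * (a\<^sup>2 - 1)\<^sup>2 + 3600 * a\<^sup>2 * w\<^sup>2 - 960 * a * w^3 + 456 * w^4 - 1200 * w\<^sup>2"
proof -
  define \<alpha> \<gamma> where "\<alpha> = (w - (a - 1)) / 2" and "\<gamma> = (5 * (a - 1) + 3 * w) / 8"
  define E where "E = 12000 * (s^3 - \<alpha>^3) + 10240 * \<gamma>^3 - 12800 * \<alpha>\<^sup>2 * \<gamma>\<^sup>2 - 8192/3 * \<gamma>^4"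
  have a: "a = 1 - 3/4 * \<alpha> + \<gamma>" and w_eq: "w = 5/4 * \<alpha> + \<gamma>"
    by (simp_all add: \<alpha>_def \<gamma>_def field_simps)
  have s2': "s\<^sup>2 = \<alpha>\<^sup>2 + 16/15 * \<gamma>\<^sup>2"
  proof -
    have "20 * (a - 1)\<^sup>2 + 12 * w\<^sup>2 = 30 * (\<alpha>\<^sup>2 + 16/15 * \<gamma>\<^sup>2)"
      unfolding a w_eq by (simp add: power2_eq_square algebra_simps)
    then show ?thesis using s2 by simp
  qed
  then have \<gamma>2: "\<gamma>\<^sup>2 = 15/16 * (s\<^sup>2 - \<alpha>\<^sup>2)" by simp
  \<comment> \<open>Even powers of \<open>s\<close> can be eliminated by \<open>s2'\<close>; only
    \<open>s^3\<close> survives into \<open>E\<close>.\<close>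
  have s3: "6000 * s\<^sup>2 * (1 - s)\<^sup>2 = 6000 * s\<^sup>2 - 12000 * s^3 + 6000 * (s\<^sup>2)\<^sup>2"
    by algebra
  have diff: "1000 * (a\<^sup>2 - 1)\<^sup>2 + 3600 * a\<^sup>2 * w\<^sup>2 - 960 * a * w^3 + 456 * w^4 - 1200 * w\<^sup>2
      - 6000 * s\<^sup>2 * (1 - s)\<^sup>2 = E"
  proof -
    \<comment> \<open>The rescaling clears the denominators of \<open>a\<close>, \<open>w\<close>
      and s^2, so that both sides expand with integer coefficients.\<close>
    define p r where "p = \<alpha> / 4" and "r = \<gamma> / 15"
    have \<alpha>\<gamma>: "\<alpha> = 4 * p" "\<gamma> = 15 * r" by (simp_all add: p_def r_def)
    have s2'': "s\<^sup>2 = 16 * p\<^sup>2 + 240 * r\<^sup>2"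
      unfolding s2' \<alpha>\<gamma> by (simp add: power_mult_distrib)
    have aw: "a = 1 - 3 * p + 15 * r" "w = 5 * p + 15 * r"
      by (simp_all add: a w_eq \<alpha>\<gamma>)
    show ?thesis
      unfolding s3 unfolding s2'' aw E_def \<alpha>\<gamma>
      by (simp add: algebra_simps power2_eq_square power3_eq_cube power4_eq_xxxx)
  qed
  have "0 \<le> E"
  proof (cases "s = 0")
    case True
    then have "20 * (a - 1)\<^sup>2 + 12 * w\<^sup>2 = 0" using s2 by simp
    then have "(a - 1)\<^sup>2 = 0" "w\<^sup>2 = 0"
      using zero_le_power2[of "a - 1"] zero_le_power2[of w] by linarith+
    then have "\<alpha> = 0" "\<gamma> = 0" by (simp_all add: \<alpha>_def \<gamma>_def)
    then show ?thesis using True by (simp add: E_def)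
  next
    case False
    with s have spos: "0 < s" by simp
    have "\<alpha>\<^sup>2 \<le> s\<^sup>2" using s2' by simp
    then have \<alpha>s: "- s \<le> \<alpha>" "\<alpha> \<le> s"
      using s abs_le_square_iff[of \<alpha> s] by auto
    have \<gamma>4: "\<gamma>^4 = 225/256 * (s\<^sup>2 - \<alpha>\<^sup>2)\<^sup>2"
    proof -
      have "\<gamma>^4 = (\<gamma>\<^sup>2)\<^sup>2" by simp
      then show ?thesis unfolding \<gamma>2 power_mult_distrib by (simp add: power2_eq_square)
    qed
    \<comment> \<open>\<open>- 2 * R\<close> collects the quartic terms of \<open>E\<close> once
      \<gamma>^2 is eliminated. As 2 s \<le> 1, these terms multiplied by \<open>s\<close> are at
      least \<open>- R\<close>.\<close>
    define R where "R = 6000 * \<alpha>\<^sup>2 * (s\<^sup>2 - \<alpha>\<^sup>2) + 1200 * (s\<^sup>2 - \<alpha>\<^sup>2)\<^sup>2"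
    have "0 \<le> R" using \<open>\<alpha>\<^sup>2 \<le> s\<^sup>2\<close> by (simp add: R_def)
    then have sR: "2 * s * R \<le> R"
      using s mult_right_mono[of "2 * s" 1 R] by simp
    have E: "E = 12000 * (s^3 - \<alpha>^3) + 10240 * \<gamma>^3 - 2 * R"
      unfolding E_def R_def \<gamma>4 \<gamma>2 by simp
    have sE: "12000 * s * (s^3 - \<alpha>^3) + 10240 * s * \<gamma>^3 - R \<le> s * E"
      unfolding E using sR by (simp add: algebra_simps)
    \<comment> \<open>Both cases produce the factor \<open>s - \<alpha>\<close>, which vanishes on
      the segment, times a nonnegative cubic. For \<gamma> \<ge> 0 the term in \<gamma>^3 is
      dropped; for \<gamma> < 0 the condition w \<ge> 0 makes it comparable to \<alpha>
      \<gamma>^2.\<close>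
    have "0 \<le> 12000 * s * (s^3 - \<alpha>^3) + 10240 * s * \<gamma>^3 - R"
    proof (cases "0 \<le> \<gamma>")
      case True
      have "9 * s^3 + 9 * s\<^sup>2 * \<alpha> + 6 * s * \<alpha>\<^sup>2 - 4 * \<alpha>^3
          = 9 * s\<^sup>2 * (s + \<alpha>) + 2 * s * \<alpha>\<^sup>2 + 4 * \<alpha>\<^sup>2 * (s - \<alpha>)"
        by algebra
      also have "\<dots> \<ge> 0"
      proof -
        have "0 \<le> s + \<alpha>" "0 \<le> s - \<alpha>" using \<alpha>s by simp_all
        from mult_nonneg_nonneg[OF _ this(1), of "9 * s\<^sup>2"] mult_nonneg_nonneg[OF _ this(2), of "4 * \<alpha>\<^sup>2"]
        show ?thesis using spos by simp
      qed
      finally have "0 \<le> 1200 * (s - \<alpha>) * (9 * s^3 + 9 * s\<^sup>2 * \<alpha> + 6 * s * \<alpha>\<^sup>2 - 4 * \<alpha>^3)"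
        using \<alpha>s by simp
      also have "\<dots> = 12000 * s * (s^3 - \<alpha>^3) - R"
        unfolding R_def by (simp add: algebra_simps power2_eq_square power3_eq_cube)
      finally have "0 \<le> 12000 * s * (s^3 - \<alpha>^3) - R" .
      moreover have "0 \<le> 10240 * s * \<gamma>^3" using True spos by simp
      ultimately show ?thesis by linarith
    next
      case False
      then have \<alpha>pos: "0 < \<alpha>" and g: "- \<gamma> \<le> 5/4 * \<alpha>" using w w_eq by auto
      have "- (\<gamma>^3) \<le> 5/4 * \<alpha> * \<gamma>\<^sup>2"
        using mult_right_mono[OF g, of "\<gamma>\<^sup>2"] by (simp add: power2_eq_square power3_eq_cube)
      then have "10240 * s * - (\<gamma>^3) \<le> 10240 * s * (5/4 * \<alpha> * \<gamma>\<^sup>2)"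
        using spos by (intro mult_left_mono) auto
      also have "\<dots> = 12000 * s * \<alpha> * (s\<^sup>2 - \<alpha>\<^sup>2)"
        unfolding \<gamma>2 by simp
      finally have 1: "- (10240 * s * \<gamma>^3) \<le> 12000 * s * \<alpha> * (s\<^sup>2 - \<alpha>\<^sup>2)" by simp
      have "9 * s^3 - s\<^sup>2 * \<alpha> - 4 * s * \<alpha>\<^sup>2 - 4 * \<alpha>^3
          = (s - \<alpha>) * (9 * s\<^sup>2 + 8 * s * \<alpha> + 4 * \<alpha>\<^sup>2)"
        by algebra
      then have "0 \<le> 1200 * (s - \<alpha>) * (9 * s^3 - s\<^sup>2 * \<alpha> - 4 * s * \<alpha>\<^sup>2 - 4 * \<alpha>^3)"
        using \<alpha>s spos \<alpha>pos by simp
      also have "\<dots> = 12000 * s * (s^3 - \<alpha>^3) - R - 12000 * s * \<alpha> * (s\<^sup>2 - \<alpha>\<^sup>2)"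
        unfolding R_def by (simp add: algebra_simps power2_eq_square power3_eq_cube)
      finally show ?thesis using 1 by linarith
    qed
    with sE have "0 \<le> s * E" by simp
    then show ?thesis using spos by (simp add: zero_le_mult_iff)
  qed
  with diff show ?thesis by simp
qed

text \<open>The left side is the value of the right side at the extremal spectrum (a - w, a - w, a -
  w, a + 3 w, -4 a) with a = -m/4. Since \<open>q\<close> enters negatively, the upper bounds on the
  cubic and quartic sums suffice.\<close>

lemma traceless_5_cases:
  fixes x1 x2 x3 x4 m :: real
  assumes sum0: "x1 + x2 + x3 + x4 + m = 0" and min: "m \<le> x1" "m \<le> x2" "m \<le> x3" "m \<le> x4"
    and t: "t = x1\<^sup>2 + x2\<^sup>2 + x3\<^sup>2 + x4\<^sup>2 + m\<^sup>2"
    and q: "q = x1^4 + x2^4 + x3^4 + x4^4 + m^4"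
  obtains w where "0 \<le> w" "t = 20 * (m/4)\<^sup>2 + 12 * w\<^sup>2"
    "1000 * ((- m/4)\<^sup>2 - 1)\<^sup>2 + 3600 * (- m/4)\<^sup>2 * w\<^sup>2 - 960 * (- m/4) * w^3 + 456 * w^4 - 1200 * w\<^sup>2
      \<le> 1000 - 100 * t + 9 * t\<^sup>2 - 10 * q"
proof -
  define a where "a = - m / 4"
  \<comment> \<open>The least of five numbers with sum zero is at most zero. This sign lets the
    bound on \<open>C\<close> be multiplied by \<open>a\<close>.\<close>
  have "0 \<le> a" using sum0 min by (simp add: a_def)
  define y1 y2 y3 y4 where "y1 = x1 - a" and "y2 = x2 - a" and "y3 = x3 - a" and "y4 = x4 - a"
  have ys: "y1 + y2 + y3 + y4 = 0"
    using sum0 by (simp add: y1_def y2_def y3_def y4_def a_def)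
  then have y4: "y4 = - y1 - y2 - y3" by simp
  have xs: "x1 = a + y1" "x2 = a + y2" "x3 = a + y3" "x4 = a + y4" "m = - 4 * a"
    by (simp_all add: y1_def y2_def y3_def y4_def a_def)
  define w where "w = sqrt ((y1\<^sup>2 + y2\<^sup>2 + y3\<^sup>2 + y4\<^sup>2) / 12)"
  have w: "0 \<le> w" and w2: "y1\<^sup>2 + y2\<^sup>2 + y3\<^sup>2 + y4\<^sup>2 = 12 * w\<^sup>2"
    by (simp_all add: w_def)
  define C D where "C = y1^3 + y2^3 + y3^3 + y4^3" and "D = y1^4 + y2^4 + y3^4 + y4^4"
  have C: "C \<le> 24 * w^3"
    unfolding C_def by (rule sum_cube_le_4[OF ys w2 w])
  have D: "D \<le> 84 * w^4"
    using power4_sum_le_4[OF ys] unfolding D_def w2 by (simp add: power_mult_distrib)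
  have "t = 20 * a\<^sup>2 + (y1\<^sup>2 + y2\<^sup>2 + y3\<^sup>2 + y4\<^sup>2)"
    unfolding t xs y4 by algebra
  then have t': "t = 20 * a\<^sup>2 + 12 * w\<^sup>2" unfolding w2 .
  have "q = 260 * a^4 + 6 * a\<^sup>2 * (y1\<^sup>2 + y2\<^sup>2 + y3\<^sup>2 + y4\<^sup>2) + 4 * a * C + D"
    unfolding q xs C_def D_def y4 by algebra
  then have q': "q = 260 * a^4 + 72 * a\<^sup>2 * w\<^sup>2 + 4 * a * C + D" unfolding w2 by simp
  have "a * C \<le> a * (24 * w^3)"
    using C \<open>0 \<le> a\<close> by (rule mult_left_mono)
  moreover have "1000 - 100 * t + 9 * t\<^sup>2 - 10 * q =
    1000 * (a\<^sup>2 - 1)\<^sup>2 + 3600 * a\<^sup>2 * w\<^sup>2 - 960 * a * w^3 + 456 * w^4 - 1200 * w\<^sup>2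
    + 40 * (a * (24 * w^3) - a * C) + 10 * (84 * w^4 - D)"
    unfolding t' q' by algebra
  ultimately have "1000 * (a\<^sup>2 - 1)\<^sup>2 + 3600 * a\<^sup>2 * w\<^sup>2 - 960 * a * w^3 + 456 * w^4 - 1200 * w\<^sup>2
      \<le> 1000 - 100 * t + 9 * t\<^sup>2 - 10 * q"
    using D by simp
  moreover have "t = 20 * (m/4)\<^sup>2 + 12 * w\<^sup>2" using t' by (simp add: a_def)
  ultimately show thesis using that[OF w] unfolding a_def by simp
qed

text \<open>In units of the vacuum value and up to a positive factor, the bracket is the potential
  and \<open>6000 * s\<^sup>2 * (1 - s)\<^sup>2\<close> its value on the segment; the hypothesis on
  \<open>s\<close> is the squared distance formula.\<close>

lemma potential_ineq:
  fixes x1 x2 x3 x4 m s t q :: real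
  assumes "x1 + x2 + x3 + x4 + m = 0" "m \<le> x1" "m \<le> x2" "m \<le> x3" "m \<le> x4"
    and "t = x1\<^sup>2 + x2\<^sup>2 + x3\<^sup>2 + x4\<^sup>2 + m\<^sup>2"
    and "q = x1^4 + x2^4 + x3^4 + x4^4 + m^4"
  shows "0 \<le> 1000 - 100 * t + 9 * t\<^sup>2 - 10 * q"
    and "0 \<le> s \<Longrightarrow> s \<le> 1/2 \<Longrightarrow> 30 * s\<^sup>2 = t + 20 + 10 * m \<Longrightarrow>
      6000 * s\<^sup>2 * (1 - s)\<^sup>2 \<le> 1000 - 100 * t + 9 * t\<^sup>2 - 10 * q"
proof -
  obtain w where w: "0 \<le> w" and t: "t = 20 * (m/4)\<^sup>2 + 12 * w\<^sup>2" and
    le: "1000 * ((- m/4)\<^sup>2 - 1)\<^sup>2 + 3600 * (- m/4)\<^sup>2 * w\<^sup>2 - 960 * (- m/4) * w^3 + 456 * w^4 - 1200 * w\<^sup>2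
      \<le> 1000 - 100 * t + 9 * t\<^sup>2 - 10 * q"
    using traceless_5_cases[OF assms] by blast
  \<comment> \<open>For a, w \<ge> 0 this sum of squares vanishes only at the two vacua: a = 1, w =
    0 and a = 1/4, w = 5/4.\<close>
  have "1000 * (a\<^sup>2 - 1)\<^sup>2 + 3600 * a\<^sup>2 * w\<^sup>2 - 960 * a * w^3 + 456 * w^4 - 1200 * w\<^sup>2
      = 5/2 * (20 * a\<^sup>2 + 12 * w\<^sup>2 - 20)\<^sup>2 + 96 * (w * (5 * a - w))\<^sup>2" for a
    by (simp add: algebra_simps power2_eq_square power3_eq_cube power4_eq_xxxx)
  then have "0 \<le> 1000 * (a\<^sup>2 - 1)\<^sup>2 + 3600 * a\<^sup>2 * w\<^sup>2 - 960 * a * w^3 + 456 * w^4 - 1200 * w\<^sup>2" for a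
    by simp
  from order_trans[OF this le] show "0 \<le> 1000 - 100 * t + 9 * t\<^sup>2 - 10 * q" .
  assume s: "0 \<le> s" "s \<le> 1/2" "30 * s\<^sup>2 = t + 20 + 10 * m"
  have "30 * s\<^sup>2 = 20 * (- m/4 - 1)\<^sup>2 + 12 * w\<^sup>2"
    using s(3) unfolding t by (simp add: power2_eq_square field_simps)
  from order_trans[OF segment_ineq[OF w s(1,2) this] le]
  show "6000 * s\<^sup>2 * (1 - s)\<^sup>2 \<le> 1000 - 100 * t + 9 * t\<^sup>2 - 10 * q" .
qed

subsection \<open>Diagonalization\<close>

lemma adjoint_mat_mat_1 [simp]: "adjoint_mat (mat 1 :: complex^'n^'n) = mat 1"
  by (auto simp: adjoint_mat_def mat_def vec_eq_iff)

text \<open>Complex multiples are written row by row, the form in which \<open>det_rows_mul\<close>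
  extracts the factors.\<close>

lemma adjoint_mat_scale:
  "adjoint_mat (\<chi> i. c *s A $ i) = (\<chi> i. cnj c *s adjoint_mat A $ i)"
  by (simp add: adjoint_mat_def vec_eq_iff)

lemma scale_matrix_mult:
  fixes A B :: "complex^'n^'n"
  shows "(\<chi> i. c *s A $ i) ** (\<chi> i. d *s B $ i) = (\<chi> i. (c * d) *s (A ** B) $ i)"
  by (simp add: matrix_matrix_mult_def vec_eq_iff sum_distrib_left mult_ac)

lemma det_adjoint_mat: "det (adjoint_mat A) = cnj (det A)"
proof -
  have "det (adjoint_mat A) = det (\<chi> i j. cnj (A $ i $ j))"
    by (subst det_transpose [symmetric]) (simp add: transpose_def adjoint_mat_def)
  also have "\<dots> = cnj (det A)"
    by (simp add: det_def cnj_sum cnj_prod)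
  finally show ?thesis .
qed

text \<open>A phase makes the determinant of a unitary matrix equal to 1 without changing conjugation by it.\<close>

lemma unitary_conj_SU5:
  fixes U :: "complex^5^5"
  assumes U: "adjoint_mat U ** U = mat 1"
  obtains W where "W \<in> SU5" "\<And>A. adjoint_mat W ** A ** W = adjoint_mat U ** A ** U"
    "\<And>A. W ** A ** adjoint_mat W = U ** A ** adjoint_mat U"
proof -
  have U': "U ** adjoint_mat U = mat 1"
    using U matrix_left_right_inverse by blast
  have "cnj (det U) * det U = 1"
    using arg_cong[OF U, of det] by (simp add: det_mul det_adjoint_mat)
  then have detU: "cmod (det U) = 1"
    by (metis complex_mod_cnj norm_mult norm_one mult_cancel_left1 norm_ge_zero abs_norm_cancel abs_square_eq_1 power2_eq_square)
  \<comment> \<open>A fifth root of the inverse determinant, because scaling five rows multiplies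
    the determinant by \<open>c ^ 5\<close>.\<close>
  define c where "c = exp (- Ln (det U) / 5)"
  have "c ^ 5 = exp (- Ln (det U))"
    unfolding c_def by (simp flip: exp_of_nat_mult)
  moreover have "exp (- Ln (det U)) = inverse (det U)"
    using detU by (subst exp_minus, subst exp_Ln) auto
  moreover have "det U \<noteq> 0" using detU by auto
  ultimately have c5: "c ^ 5 * det U = 1"
    by (metis left_inverse)
  have "cmod c ^ 5 = 1"
    using arg_cong[OF c5, of cmod] detU by (simp add: norm_mult norm_power)
  then have "cmod c = 1"
    using power_eq_imp_eq_base[of "cmod c" 5 1] by simp
  then have c: "cnj c * c = 1" "c * cnj c = 1"
    by (simp_all add: complex_norm_square[symmetric] mult.commute)
  define W where "W = (\<chi> i. c *s U $ i)"
  have one: "(\<chi> i. 1 *s A $ i) = A" for A :: "complex^5^5" by simp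
  have W: "adjoint_mat W ** W = mat 1" "W ** adjoint_mat W = mat 1"
    unfolding W_def adjoint_mat_scale scale_matrix_mult c one U U' by simp_all
  have "det W = c ^ 5 * det U"
    unfolding W_def det_rows_mul by simp
  with c5 W have "W \<in> SU5" by (simp add: SU5_def)
  moreover have "adjoint_mat W ** A ** W = adjoint_mat U ** A ** U" for A
    unfolding W_def adjoint_mat_scale
    using scale_matrix_mult[of "cnj c" "adjoint_mat U" 1 A] scale_matrix_mult[of "cnj c" "adjoint_mat U ** A" c U]
    by (simp add: c)
  moreover have "W ** A ** adjoint_mat W = U ** A ** adjoint_mat U" for A
    unfolding W_def adjoint_mat_scale
    using scale_matrix_mult[of "c" U 1 A] scale_matrix_mult[of c "U ** A" "cnj c" "adjoint_mat U"]
    by (simp add: c)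
  ultimately show thesis using that by blast
qed

text \<open>Hermitian and, for r^2 + |q|^2 = 1, an involution, so conjugation by it needs no
  separate inverse. It supplies the variations of the maximizer.\<close>

definition plane_refl :: "'n \<Rightarrow> 'n \<Rightarrow> real \<Rightarrow> complex \<Rightarrow> complex^'n^'n"
  where "plane_refl i j r q = (\<chi> k l.
    if k = i then (if l = i then of_real r else if l = j then q else 0)
    else if k = j then (if l = i then cnj q else if l = j then - of_real r else 0)
    else if k = l then 1 else 0)"

lemma sum_pair:
  fixes f g :: "'n::finite \<Rightarrow> complex"
  assumes "i \<noteq> j"
  shows "(\<Sum>k\<in>UNIV. (if k = i then a else if k = j then b else 0) * f k) = a * f i + b * f j"
proof -
  have "(\<Sum>k\<in>UNIV. (if k = i then a else if k = j then b else 0) * f k)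
      = (\<Sum>k\<in>UNIV. (if k = i then a * f k else 0) + (if k = j then b * f k else 0))"
    using assms by (intro sum.cong) auto
  then show ?thesis by (simp add: sum.distrib)
qed

lemma plane_refl_mult:
  assumes "i \<noteq> j"
  shows "(plane_refl i j r q ** A) $ k $ l =
    (if k = i then of_real r * A $ i $ l + q * A $ j $ l
     else if k = j then cnj q * A $ i $ l - of_real r * A $ j $ l else A $ k $ l)"
proof -
  have "(\<Sum>m\<in>UNIV. (if k = m then 1 else 0) * A $ m $ l) = A $ k $ l"
    by (simp add: if_distrib if_distribR sum.delta cong: if_cong)
  then show ?thesis
    using sum_pair[OF assms] by (simp add: plane_refl_def matrix_matrix_mult_def)
qed

lemma adjoint_plane_refl [simp]: "i \<noteq> j \<Longrightarrow> adjoint_mat (plane_refl i j r q) = plane_refl i j r q"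
  by (auto simp: plane_refl_def adjoint_mat_def vec_eq_iff)

lemma plane_refl_unitary:
  assumes "i \<noteq> j" "r\<^sup>2 + (cmod q)\<^sup>2 = 1"
  shows "plane_refl i j r q ** plane_refl i j r q = mat 1"
proof -
  have "complex_of_real r * of_real r + q * cnj q = 1"
    using arg_cong[OF assms(2), of complex_of_real]
    by (simp only: of_real_add complex_norm_square) (simp add: power2_eq_square)
  then show ?thesis
    using assms(1) unfolding vec_eq_iff plane_refl_mult[OF assms(1)]
    by (auto simp: plane_refl_def mat_def algebra_simps)
qed

text \<open>Conjugation preserves the trace of the block on \<open>i\<close>, \<open>j\<close>, so
  one diagonal entry gains what the other loses.\<close>

lemma plane_refl_conj_diag:
  assumes ij: "i \<noteq> j" and r: "r\<^sup>2 + (cmod q)\<^sup>2 = 1" and A: "adjoint_mat A = A"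
  shows "Re ((plane_refl i j r q ** A ** plane_refl i j r q) $ k $ k) = Re (A $ k $ k) +
    (if k = i then 1 else if k = j then - 1 else 0) *
    ((cmod q)\<^sup>2 * (Re (A $ j $ j) - Re (A $ i $ i)) + 2 * r * Re (A $ i $ j * cnj q))"
proof -
  let ?H = "plane_refl i j r q"
  have herm: "A $ k $ l = cnj (A $ l $ k)" for k l
    using arg_cong[OF A, of "\<lambda>B. B $ k $ l"] by (simp add: adjoint_mat_def)
  \<comment> \<open>Taking adjoints turns the right factor into a left one, so the row formula for
    \<open>plane_refl\<close> serves on both sides.\<close>
  have "?H ** A ** ?H = adjoint_mat (?H ** adjoint_mat (?H ** A))"
    using ij by (simp add: adjoint_mat_mult)
  then have eq: "Re ((?H ** A ** ?H) $ k $ k) = Re ((?H ** adjoint_mat (?H ** A)) $ k $ k)"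
    by (simp add: adjoint_mat_def)
  have entry: "adjoint_mat (?H ** A) $ k $ l = cnj ((?H ** A) $ l $ k)" for k l
    by (simp add: adjoint_mat_def)
  have r2: "r * (r * x) = x - Re q * (Re q * x) - Im q * (Im q * x)" for x
  proof -
    have "r * r = 1 - Re q * Re q - Im q * Im q"
      using r cmod_power2[of q] unfolding power2_eq_square by linarith
    then have "(r * r) * x = (1 - Re q * Re q - Im q * Im q) * x" by simp
    then show ?thesis by (simp add: algebra_simps)
  qed
  have Im0: "Im (A $ k $ k) = 0" for k
    using arg_cong[OF herm[of k k], of Im] by simp
  have ji: "Re (A $ j $ i) = Re (A $ i $ j)" "Im (A $ j $ i) = - Im (A $ i $ j)"
    using herm[of j i] by simp_all
  have q2: "cmod q * (cmod q * x) = Re q * (Re q * x) + Im q * (Im q * x)" for x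
    using arg_cong[OF cmod_power2[of q], of "\<lambda>y. y * x"] by (simp add: power2_eq_square algebra_simps)
  show ?thesis
    unfolding eq plane_refl_mult[OF ij] entry
    unfolding power2_eq_square
    using ij by (auto simp: Im0 ji r2 q2 algebra_simps)
qed

text \<open>The optimality condition at a maximizer: for small \<open>q\<close> the term linear in
  \<open>z\<close> would outweigh the quadratic one.\<close>

lemma plane_form_nonpos:
  fixes D :: real and z :: complex
  assumes form: "\<And>r q. r\<^sup>2 + (cmod q)\<^sup>2 = 1 \<Longrightarrow> (cmod q)\<^sup>2 * D + 2 * r * Re (z * cnj q) \<le> 0"
  shows "D \<le> 0" and "z = 0"
proof -
  show "D \<le> 0" using form[of 0 1] by simp
  show "z = 0"
  proof (rule ccontr)
    assume "z \<noteq> 0"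
    define N where "N = sqrt ((1 - D)\<^sup>2 + (cmod z)\<^sup>2)"
    have N2: "N\<^sup>2 = (1 - D)\<^sup>2 + (cmod z)\<^sup>2" by (simp add: N_def)
    have "0 < (1 - D)\<^sup>2 + (cmod z)\<^sup>2" using \<open>z \<noteq> 0\<close> by (simp add: add_nonneg_pos)
    then have "0 < N" by (simp add: N_def)
    \<comment> \<open>At this point the form equals |z|^2 (2 - D) / N^2, which is positive because D
      \<le> 0.\<close>
    define r q where "r = (1 - D) / N" and "q = z / of_real N"
    have q2: "(cmod q)\<^sup>2 = (cmod z)\<^sup>2 / N\<^sup>2"
      using \<open>0 < N\<close> by (simp add: q_def norm_divide power_divide)
    have "r\<^sup>2 + (cmod q)\<^sup>2 = 1"
      unfolding q2 using \<open>0 < N\<close> by (simp add: r_def power_divide N2[symmetric] flip: add_divide_distrib)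
    note form_q = form[OF this]
    have Re_zq: "Re (z * cnj q) = (cmod z)\<^sup>2 / N"
      unfolding q_def cmod_power2 by (simp add: add_divide_distrib power2_eq_square)
    have "(cmod z)\<^sup>2 / N\<^sup>2 * (D + 2 * (1 - D)) = (cmod z)\<^sup>2 / N\<^sup>2 * D + 2 * r * ((cmod z)\<^sup>2 / N)"
      using \<open>0 < N\<close> by (simp add: r_def power2_eq_square field_simps)
    also have "\<dots> \<le> 0"
      using form_q unfolding q2 Re_zq .
    finally have "(cmod z)\<^sup>2 / N\<^sup>2 * (D + 2 * (1 - D)) \<le> 0" .
    moreover have "0 < (cmod z)\<^sup>2 / N\<^sup>2" using \<open>z \<noteq> 0\<close> \<open>0 < N\<close> by simp
    ultimately have "D + 2 * (1 - D) \<le> 0" by (meson mult_pos_pos not_less)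
    with \<open>D \<le> 0\<close> show False by simp
  qed
qed

text \<open>A reflection changes the functional by \<open>(d i - d j) * X i j r q\<close>. Distinct
  weights make the factor nonzero, so maximality fixes the sign of the form for each pair, which
  kills the off-diagonal entry and orders the diagonal ones.\<close>

lemma hermitian_diagonalize:
  fixes Q :: "complex^5^5" and d :: "5 \<Rightarrow> real"
  assumes Q: "adjoint_mat Q = Q" and d: "inj d"
  obtains U and x :: "5 \<Rightarrow> real"
  where "U \<in> SU5" "Q = adjoint_mat U ** diag_matrix (\<chi> i. of_real (x i)) ** U"
    "\<And>i j. d i < d j \<Longrightarrow> x i \<le> x j"
proof -
  define f where "f U = (\<Sum>k\<in>UNIV. d k * Re ((U ** Q ** adjoint_mat U) $ k $ k))" for U :: "complex^5^5"
  have "continuous_on SU5 f"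
    unfolding f_def by (intro continuous_intros)
  moreover have "SU5 \<noteq> {}"
    using SU5_orbit_nonempty by (auto simp: SU5_orbit_def)
  ultimately obtain U where U: "U \<in> SU5" and max: "\<And>W. W \<in> SU5 \<Longrightarrow> f W \<le> f U"
    using continuous_attains_sup[OF compact_SU5] by blast
  have UU: "adjoint_mat U ** U = mat 1" using U by (simp add: SU5_def)
  define A where "A = U ** Q ** adjoint_mat U"
  have A: "adjoint_mat A = A"
    by (simp add: A_def adjoint_mat_mult Q matrix_mul_assoc)
  define X where "X i j r q = (cmod q)\<^sup>2 * (Re (A $ j $ j) - Re (A $ i $ i)) + 2 * r * Re (A $ i $ j * cnj q)"
    for i j r q
  have var: "(d i - d j) * X i j r q \<le> 0" if ij: "i \<noteq> j" and r: "r\<^sup>2 + (cmod q)\<^sup>2 = 1" for i j r q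
  proof -
    let ?H = "plane_refl i j r q :: complex^5^5"
    have "adjoint_mat (?H ** U) ** (?H ** U) = adjoint_mat U ** (?H ** ?H) ** U"
      using ij by (simp add: adjoint_mat_mult matrix_mul_assoc)
    also have "\<dots> = mat 1"
      by (simp add: plane_refl_unitary[OF ij r] UU)
    finally have HU: "adjoint_mat (?H ** U) ** (?H ** U) = mat 1" .
    \<comment> \<open>The reflection has determinant -1, so \<open>?H ** U\<close> lies outside
      \<open>SU5\<close>; a phase brings it back.\<close>
    obtain W where W: "W \<in> SU5" "\<And>A. W ** A ** adjoint_mat W = ?H ** U ** A ** adjoint_mat (?H ** U)"
      by (rule unitary_conj_SU5[OF HU]) blast
    have WA: "W ** Q ** adjoint_mat W = ?H ** A ** ?H"
      unfolding W(2) A_def using ij by (simp add: adjoint_mat_mult matrix_mul_assoc)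
    have "f W = (\<Sum>k\<in>UNIV. d k * Re (A $ k $ k)
        + (if k = i then d i * X i j r q else 0) + (if k = j then - (d j * X i j r q) else 0))"
      unfolding f_def WA plane_refl_conj_diag[OF ij r A] X_def[symmetric]
      using ij by (intro sum.cong refl) (auto simp: algebra_simps)
    also have "\<dots> = f U + (d i - d j) * X i j r q"
      by (simp add: sum.distrib f_def A_def algebra_simps)
    finally show ?thesis using max[OF W(1)] by simp
  qed
  have key: "A $ i $ j = 0" "Re (A $ i $ i) \<ge> Re (A $ j $ j)" if "d j < d i" for i j
  proof -
    have "i \<noteq> j" using that by auto
    have "X i j r q \<le> 0" if "r\<^sup>2 + (cmod q)\<^sup>2 = 1" for r q
      using var[OF \<open>i \<noteq> j\<close> that] \<open>d j < d i\<close> by (simp add: mult_le_0_iff)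
    from plane_form_nonpos[of "Re (A $ j $ j) - Re (A $ i $ i)" "A $ i $ j", OF this[unfolded X_def]]
    show "A $ i $ j = 0" "Re (A $ i $ i) \<ge> Re (A $ j $ j)" by simp_all
  qed
  have herm: "A $ k $ l = cnj (A $ l $ k)" for k l
    using arg_cong[OF A, of "\<lambda>B. B $ k $ l"] by (simp add: adjoint_mat_def)
  have off: "A $ i $ j = 0" if "i \<noteq> j" for i j
  proof -
    have "d i \<noteq> d j" using that d by (auto dest: injD)
    then consider "d j < d i" | "d i < d j" by linarith
    then show ?thesis using key(1)[of j i] key(1)[of i j] herm[of i j] by cases auto
  qed
  have "of_real (Re (A $ i $ i)) = A $ i $ i" for i
    using arg_cong[OF herm[of i i], of Im] by (simp add: complex_eq_iff)
  then have diag: "A = diag_matrix (\<chi> i. of_real (Re (A $ i $ i)))"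
    by (auto simp: diag_matrix_def vec_eq_iff off)
  have "adjoint_mat U ** A ** U = (adjoint_mat U ** U) ** Q ** (adjoint_mat U ** U)"
    by (simp add: A_def matrix_mul_assoc)
  then have "Q = adjoint_mat U ** A ** U" by (simp add: UU)
  then have "Q = adjoint_mat U ** diag_matrix (\<chi> i. of_real (Re (A $ i $ i))) ** U"
    using diag by simp
  with U key(2) show thesis by (intro that) auto
qed

subsection \<open>Distances to the vacuum orbits\<close>

definition real_diag :: "('n \<Rightarrow> real) \<Rightarrow> complex^'n^'n"
  where "real_diag x = diag_matrix (\<chi> i. of_real (x i))"

lemma real_diag_nth: "real_diag x $ i $ j = (if i = j then of_real (x i) else 0)"
  by (simp add: real_diag_def diag_matrix_def)

lemma real_diag_mult_nth:
  fixes x :: "'n::finite \<Rightarrow> real"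
  shows "(real_diag x ** A) $ i $ j = of_real (x i) * A $ i $ j"
  by (simp add: matrix_matrix_mult_def real_diag_nth if_distrib if_distribR sum.delta cong: if_cong)

lemma real_diag_mult: "real_diag x ** real_diag y = real_diag (\<lambda>i. x i * y i)"
  for x y :: "'n::finite \<Rightarrow> real"
  by (simp add: vec_eq_iff real_diag_mult_nth) (simp add: real_diag_nth)

lemma trace_real_diag: "trace (real_diag x) = of_real (sum x UNIV)"
  by (simp add: trace_def real_diag_nth)

lemma adjoint_real_diag [simp]: "adjoint_mat (real_diag x) = real_diag x"
  by (auto simp: adjoint_mat_def real_diag_nth vec_eq_iff)

section \<open>Traces and the potential under unitary conjugation\<close>

lemma conj_mult:
  assumes "U ** adjoint_mat U = mat 1"
  shows "(adjoint_mat U ** A ** U) ** (adjoint_mat U ** B ** U) = adjoint_mat U ** (A ** B) ** U"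
proof -
  have "(adjoint_mat U ** A ** U) ** (adjoint_mat U ** B ** U)
      = adjoint_mat U ** A ** (U ** adjoint_mat U) ** B ** U"
    by (simp add: matrix_mul_assoc)
  then show ?thesis by (simp add: assms matrix_mul_assoc)
qed

lemma trace_conj:
  fixes U A :: "complex^'n^'n"
  assumes "U ** adjoint_mat U = mat 1"
  shows "trace (adjoint_mat U ** A ** U) = trace A"
proof -
  have "trace (adjoint_mat U ** A ** U) = trace (U ** adjoint_mat U ** A)"
    by (subst trace_mul_sym) (simp add: matrix_mul_assoc)
  then show ?thesis by (simp add: assms)
qed

lemma potential_conj_real_diag:
  assumes "U \<in> SU5"
  shows "potential \<mu> h lam V0 (adjoint_mat U ** real_diag x ** U) =
    - \<mu>\<^sup>2 * (\<Sum>i\<in>UNIV. (x i)\<^sup>2) + h * (\<Sum>i\<in>UNIV. (x i)\<^sup>2)\<^sup>2 + lam * (\<Sum>i\<in>UNIV. (x i)^4) + V0"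
proof -
  have U: "U ** adjoint_mat U = mat 1" using assms by (simp add: SU5_def)
  show ?thesis
    unfolding potential_def conj_mult[OF U] trace_conj[OF U] real_diag_mult trace_real_diag
    by (simp add: power2_eq_square power4_eq_xxxx mult.assoc)
qed

section \<open>Orbits of the group and the sign change\<close>

lemma mat_1_SU5: "mat 1 \<in> SU5"
  by (simp add: SU5_def)

lemma SU5_mult: "U \<in> SU5 \<Longrightarrow> W \<in> SU5 \<Longrightarrow> U ** W \<in> SU5"
proof -
  assume *: "U \<in> SU5" "W \<in> SU5"
  have "adjoint_mat (U ** W) ** (U ** W) = adjoint_mat W ** (adjoint_mat U ** U) ** W"
    "(U ** W) ** adjoint_mat (U ** W) = U ** (W ** adjoint_mat W) ** adjoint_mat U"
    by (simp_all add: adjoint_mat_mult matrix_mul_assoc)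
  with * show ?thesis by (simp add: SU5_def det_mul)
qed

lemma SU5_adjoint: "U \<in> SU5 \<Longrightarrow> adjoint_mat U \<in> SU5"
  by (simp add: SU5_def det_adjoint_mat)

lemma SU5_orbit_eq:
  assumes "P \<in> SU5_orbit \<Phi>"
  shows "SU5_orbit P = SU5_orbit \<Phi>"
proof -
  have sub: "SU5_orbit (adjoint_mat W ** A ** W) \<subseteq> SU5_orbit A" if "W \<in> SU5" for W A
    using SU5_mult[OF that] by (force simp: SU5_orbit_def adjoint_mat_mult matrix_mul_assoc)
  obtain W where W: "W \<in> SU5" "P = adjoint_mat W ** \<Phi> ** W"
    using assms by (auto simp: SU5_orbit_def)
  have "\<Phi> = adjoint_mat (adjoint_mat W) ** P ** adjoint_mat W"
  proof -
    have "adjoint_mat (adjoint_mat W) ** P ** adjoint_mat W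
        = (W ** adjoint_mat W) ** \<Phi> ** (W ** adjoint_mat W)"
      by (simp add: W(2) matrix_mul_assoc)
    then show ?thesis using W(1) by (simp add: SU5_def)
  qed
  with sub[OF SU5_adjoint[OF W(1)], of P] have "SU5_orbit \<Phi> \<subseteq> SU5_orbit P"
    by metis
  with sub[OF W(1), of \<Phi>] show ?thesis
    unfolding W(2)[symmetric] by (rule subset_antisym)
qed

lemma matrix_mult_uminus:
  fixes A B :: "complex^'n^'n"
  shows "(- A) ** B = - (A ** B)" "A ** (- B) = - (A ** B)"
  by (simp_all add: matrix_matrix_mult_def vec_eq_iff sum_negf)

lemma SU5_orbit_uminus: "SU5_orbit (- \<Phi>) = uminus ` SU5_orbit \<Phi>"
  by (auto simp: SU5_orbit_def matrix_mult_uminus)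

lemma frob_norm_uminus: "frob_norm (- A) = frob_norm A"
  by (simp add: frob_norm_def matrix_mult_uminus)

lemma dist_set_uminus: "dist_set Q (uminus ` S) = dist_set (- Q) S"
proof -
  have "frob_norm (Q - (- P)) = frob_norm (- Q - P)" for P
    using frob_norm_uminus[of "- Q - P"] by (simp add: add.commute)
  then show ?thesis by (simp add: dist_set_def image_image)
qed

lemma potential_uminus: "potential \<mu> h lam V0 (- Q) = potential \<mu> h lam V0 Q"
  by (simp add: potential_def matrix_mult_uminus)

text \<open>The squared moduli form a doubly stochastic matrix, which turns traces of products into
  averages of eigenvalues.\<close>

lemma unitary_weights:
  assumes "Z \<in> SU5"
  shows "(\<Sum>k\<in>UNIV. (cmod (Z $ k $ i))\<^sup>2) = 1" "(\<Sum>i\<in>UNIV. (cmod (Z $ k $ i))\<^sup>2) = 1"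
proof -
  have "complex_of_real (\<Sum>k\<in>UNIV. (cmod (Z $ k $ i))\<^sup>2) = (adjoint_mat Z ** Z) $ i $ i"
    "complex_of_real (\<Sum>i\<in>UNIV. (cmod (Z $ k $ i))\<^sup>2) = (Z ** adjoint_mat Z) $ k $ k"
    by (simp_all add: adjoint_mat_def matrix_matrix_mult_def complex_norm_square mult.commute del: of_real_power)
  with assms show "(\<Sum>k\<in>UNIV. (cmod (Z $ k $ i))\<^sup>2) = 1" "(\<Sum>i\<in>UNIV. (cmod (Z $ k $ i))\<^sup>2) = 1"
    by (simp_all add: SU5_def mat_def del: of_real_sum of_real_power)
qed

lemma trace_diag_conj_diag:
  fixes Z :: "complex^'n^'n"
  shows "trace (real_diag x ** (adjoint_mat Z ** real_diag y ** Z)) =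
    of_real (\<Sum>i\<in>UNIV. x i * (\<Sum>k\<in>UNIV. y k * (cmod (Z $ k $ i))\<^sup>2))"
proof -
  have "(adjoint_mat Z ** real_diag y ** Z) $ i $ i = of_real (\<Sum>k\<in>UNIV. y k * (cmod (Z $ k $ i))\<^sup>2)" for i
  proof -
    have "(adjoint_mat Z ** real_diag y ** Z) $ i $ i = (\<Sum>k\<in>UNIV. cnj (Z $ k $ i) * (real_diag y ** Z) $ k $ i)"
      by (simp flip: matrix_mul_assoc) (simp add: matrix_matrix_mult_def adjoint_mat_def)
    also have "\<dots> = of_real (\<Sum>k\<in>UNIV. y k * (cmod (Z $ k $ i))\<^sup>2)"
      by (simp add: real_diag_mult_nth complex_norm_square mult_ac del: of_real_power)
    finally show ?thesis .
  qed
  then show ?thesis by (simp add: trace_def real_diag_mult_nth)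
qed

text \<open>Expanding the square, only the cross term depends on the relative unitary
  \<open>Z\<close>.\<close>

lemma frob_norm_diff:
  assumes "U \<in> SU5" "W \<in> SU5"
  defines "Z \<equiv> W ** adjoint_mat U"
  shows "frob_norm (adjoint_mat U ** real_diag x ** U - adjoint_mat W ** real_diag y ** W) =
    sqrt ((\<Sum>i\<in>UNIV. (x i)\<^sup>2) + (\<Sum>i\<in>UNIV. (y i)\<^sup>2)
      - 2 * (\<Sum>i\<in>UNIV. x i * (\<Sum>k\<in>UNIV. y k * (cmod (Z $ k $ i))\<^sup>2)))"
proof -
  define Q P where "Q = adjoint_mat U ** real_diag x ** U" and "P = adjoint_mat W ** real_diag y ** W"
  have unit: "U ** adjoint_mat U = mat 1" "W ** adjoint_mat W = mat 1"
    using assms by (simp_all add: SU5_def)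
  have QQ: "trace (Q ** Q) = of_real (\<Sum>i\<in>UNIV. (x i)\<^sup>2)" "trace (P ** P) = of_real (\<Sum>i\<in>UNIV. (y i)\<^sup>2)"
    unfolding Q_def P_def conj_mult[OF unit(1)] conj_mult[OF unit(2)] trace_conj[OF unit(1)]
      trace_conj[OF unit(2)] real_diag_mult trace_real_diag by (simp_all add: power2_eq_square)
  have "trace (Q ** P) = trace (adjoint_mat U ** (real_diag x ** U ** P))"
    by (simp add: Q_def matrix_mul_assoc)
  also have "\<dots> = trace (real_diag x ** (adjoint_mat Z ** real_diag y ** Z))"
    by (subst trace_mul_sym) (simp add: P_def Z_def adjoint_mat_mult matrix_mul_assoc)
  finally have QP: "trace (Q ** P) = of_real (\<Sum>i\<in>UNIV. x i * (\<Sum>k\<in>UNIV. y k * (cmod (Z $ k $ i))\<^sup>2))"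
    unfolding trace_diag_conj_diag .
  have diffr: "A ** (B - C) = A ** B - A ** C" "(B - C) ** A = B ** A - C ** A" for A B C :: "complex^5^5"
    by (simp_all add: matrix_matrix_mult_def vec_eq_iff sum_subtractf algebra_simps)
  have "trace ((Q - P) ** (Q - P)) = trace (Q ** Q) + trace (P ** P) - 2 * trace (Q ** P)"
    using trace_mul_sym[of P Q] by (simp add: diffr trace_sub)
  then show ?thesis
    unfolding QQ QP by (simp add: frob_norm_def flip: Q_def P_def)
qed

lemma Phi_real_diag:
  "Phi_plus \<mu> h = real_diag (\<lambda>i. if i = 5 then - 4 * vev \<mu> h else vev \<mu> h)"
  "Phi_minus \<mu> h = real_diag (\<lambda>i. if i = 4 then 4 * vev \<mu> h else - vev \<mu> h)"
  by (auto simp: Phi_plus_def Phi_minus_def vec_eq_iff forall_5 vector_5 real_diag_nth diag_matrix_def scaleR_conv_of_real[of _ "_::complex"])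

lemma Sigma_minus_eq: "Sigma_minus \<mu> h = uminus ` Sigma_plus \<mu> h"
proof -
  \<comment> \<open>With r = 0 and q = 1 this is the transposition of coordinates 4 and 5, taking
    diag(1,1,1,1,-4) to diag(1,1,1,-4,1).\<close>
  let ?S = "plane_refl 4 5 0 1 :: complex^5^5"
  have ne: "(4::5) \<noteq> 5" by simp
  have conj: "?S ** Phi_plus \<mu> h ** ?S = - Phi_minus \<mu> h"
    unfolding Phi_real_diag vec_eq_iff matrix_mul_assoc[symmetric] plane_refl_mult[OF ne] real_diag_mult_nth
    by (simp add: forall_5 real_diag_nth plane_refl_def)
  have unitary: "adjoint_mat ?S ** ?S = mat 1"
    using plane_refl_unitary[OF ne] by (simp add: ne)
  obtain W where W: "W \<in> SU5" "\<And>A. adjoint_mat W ** A ** W = adjoint_mat ?S ** A ** ?S"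
    by (rule unitary_conj_SU5[OF unitary]) blast
  have "- Phi_minus \<mu> h = adjoint_mat W ** Phi_plus \<mu> h ** W"
    using conj by (simp add: W(2) ne)
  with W(1) have "- Phi_minus \<mu> h \<in> Sigma_plus \<mu> h"
    unfolding SU5_orbit_def by blast
  from SU5_orbit_eq[OF this] have "uminus ` Sigma_minus \<mu> h = Sigma_plus \<mu> h"
    unfolding SU5_orbit_uminus .
  then show ?thesis
    by (metis SU5_orbit_uminus minus_minus)
qed

text \<open>Four eigenvalues of \<open>Phi_plus\<close> agree and the trace of \<open>x\<close> is
  zero, so the cross term reduces to an average of \<open>x\<close> with weights from row 5 of
  \<open>Z\<close>. The average is at least \<open>x 5\<close>, with equality when \<open>Z\<close>
  is the identity.\<close>

lemma dist_set_Sigma_plus: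
  assumes U: "U \<in> SU5" and sum0: "sum x UNIV = 0" and min: "\<And>i. x 5 \<le> x i"
    and v: "0 \<le> vev \<mu> h"
  shows "dist_set (adjoint_mat U ** real_diag x ** U) (Sigma_plus \<mu> h)
    = sqrt ((\<Sum>i\<in>UNIV. (x i)\<^sup>2) + 20 * (vev \<mu> h)\<^sup>2 + 10 * vev \<mu> h * x 5)"
proof -
  let ?v = "vev \<mu> h" and ?Q = "adjoint_mat U ** real_diag x ** U"
  have norm: "frob_norm (?Q - adjoint_mat W ** Phi_plus \<mu> h ** W) =
    sqrt ((\<Sum>i\<in>UNIV. (x i)\<^sup>2) + 20 * ?v\<^sup>2 + 10 * ?v * (\<Sum>i\<in>UNIV. x i * (cmod ((W ** adjoint_mat U) $ 5 $ i))\<^sup>2))"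
    if W: "W \<in> SU5" for W
  proof -
    let ?Z = "W ** adjoint_mat U"
    have "(\<Sum>k\<in>UNIV. (if k = 5 then - 4 * ?v else ?v) * (cmod (?Z $ k $ i))\<^sup>2) = ?v - 5 * ?v * (cmod (?Z $ 5 $ i))\<^sup>2" for i
    proof -
      have "(\<Sum>k\<in>UNIV. (if k = 5 then - 4 * ?v else ?v) * (cmod (?Z $ k $ i))\<^sup>2)
          = (\<Sum>k\<in>UNIV. ?v * (cmod (?Z $ k $ i))\<^sup>2 - (if k = 5 then 5 * ?v * (cmod (?Z $ k $ i))\<^sup>2 else 0))"
        by (intro sum.cong) auto
      also have "\<dots> = ?v - 5 * ?v * (cmod (?Z $ 5 $ i))\<^sup>2"
        using unitary_weights(1)[OF SU5_mult[OF W SU5_adjoint[OF U]], of i]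
        by (simp add: sum_subtractf flip: sum_distrib_left)
      finally show ?thesis .
    qed
    note inner = this
    have "(\<Sum>i\<in>UNIV. x i * (?v - 5 * ?v * (cmod (?Z $ 5 $ i))\<^sup>2))
        = ?v * sum x UNIV - 5 * ?v * (\<Sum>i\<in>UNIV. x i * (cmod (?Z $ 5 $ i))\<^sup>2)"
      by (simp add: right_diff_distrib sum_subtractf sum_distrib_left mult_ac)
    then have cross: "(\<Sum>i\<in>UNIV. x i * (\<Sum>k\<in>UNIV. (if k = 5 then - 4 * ?v else ?v) * (cmod (?Z $ k $ i))\<^sup>2))
        = - 5 * ?v * (\<Sum>i\<in>UNIV. x i * (cmod (?Z $ 5 $ i))\<^sup>2)"
      unfolding inner sum0 by simp
    have sq: "(\<Sum>k\<in>(UNIV::5 set). (if k = 5 then - 4 * ?v else ?v)\<^sup>2) = 20 * ?v\<^sup>2"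
      by (simp add: sum_5 power_mult_distrib)
    show ?thesis
      unfolding Phi_real_diag frob_norm_diff[OF U W] cross sq by simp
  qed
  have "U ** adjoint_mat U = mat 1" using U by (simp add: SU5_def)
  then have att: "frob_norm (?Q - adjoint_mat U ** Phi_plus \<mu> h ** U) =
    sqrt ((\<Sum>i\<in>UNIV. (x i)\<^sup>2) + 20 * ?v\<^sup>2 + 10 * ?v * x 5)"
    unfolding norm[OF U] by (simp add: mat_def if_distrib if_distribR sum.delta cong: if_cong)
  have "sqrt ((\<Sum>i\<in>UNIV. (x i)\<^sup>2) + 20 * ?v\<^sup>2 + 10 * ?v * x 5) \<le> frob_norm (?Q - adjoint_mat W ** Phi_plus \<mu> h ** W)"
    if W: "W \<in> SU5" for W
  proof -
    let ?p = "\<lambda>i. (cmod ((W ** adjoint_mat U) $ 5 $ i))\<^sup>2"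
    have "x 5 = (\<Sum>i\<in>UNIV. x 5 * ?p i)"
      using unitary_weights(2)[OF SU5_mult[OF W SU5_adjoint[OF U]], of 5] by (simp flip: sum_distrib_left)
    also have "\<dots> \<le> (\<Sum>i\<in>UNIV. x i * ?p i)"
      by (intro sum_mono mult_right_mono min) simp
    finally show ?thesis
      unfolding norm[OF W] using v by (simp add: mult_left_mono)
  qed
  then have "sqrt ((\<Sum>i\<in>UNIV. (x i)\<^sup>2) + 20 * ?v\<^sup>2 + 10 * ?v * x 5) \<le> y"
    if "y \<in> (\<lambda>P. frob_norm (?Q - P)) ` Sigma_plus \<mu> h" for y
    using that unfolding SU5_orbit_def by blast
  moreover have "adjoint_mat U ** Phi_plus \<mu> h ** U \<in> Sigma_plus \<mu> h"
    using U unfolding SU5_orbit_def by blast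
  then have "sqrt ((\<Sum>i\<in>UNIV. (x i)\<^sup>2) + 20 * ?v\<^sup>2 + 10 * ?v * x 5)
      \<in> (\<lambda>P. frob_norm (?Q - P)) ` Sigma_plus \<mu> h"
    unfolding att[symmetric] by (rule imageI)
  ultimately show ?thesis
    unfolding dist_set_def by (intro cInf_eq_minimum)
qed

text \<open>All points of \<open>Sigma_minus\<close> have the same spectrum, hence the same distance
  to \<open>Sigma_plus\<close>. Index 5 carries the least eigenvalue -v, giving 20 + 20 - 10 =
  30.\<close>

lemma dist_B_eq:
  assumes v: "0 \<le> vev \<mu> h"
  shows "dist_B \<mu> h = sqrt 30 * vev \<mu> h"
proof -
  have d: "dist_set P (Sigma_plus \<mu> h) = sqrt 30 * vev \<mu> h" if P: "P \<in> Sigma_minus \<mu> h" for P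
  proof -
    obtain W where W: "W \<in> SU5" "P = adjoint_mat W ** Phi_minus \<mu> h ** W"
      using P by (auto simp: SU5_orbit_def)
    let ?x = "\<lambda>i::5. if i = 4 then 4 * vev \<mu> h else - vev \<mu> h"
    have "dist_set P (Sigma_plus \<mu> h) = sqrt ((\<Sum>i\<in>UNIV. (?x i)\<^sup>2) + 20 * (vev \<mu> h)\<^sup>2 + 10 * vev \<mu> h * ?x 5)"
      unfolding W(2) Phi_real_diag(2)
      by (rule dist_set_Sigma_plus[OF W(1) _ _ v]) (use v in \<open>auto simp: sum_5\<close>)
    also have "\<dots> = sqrt (30 * (vev \<mu> h)\<^sup>2)"
      by (simp add: sum_5 power2_eq_square)
    also have "\<dots> = sqrt 30 * vev \<mu> h"
      using v by (simp add: real_sqrt_mult)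
    finally show ?thesis .
  qed
  obtain P Q where PQ: "P \<in> Sigma_minus \<mu> h" "Q \<in> Sigma_plus \<mu> h" "dist_B \<mu> h = frob_norm (P - Q)"
    and le: "\<And>P' Q'. P' \<in> Sigma_minus \<mu> h \<Longrightarrow> Q' \<in> Sigma_plus \<mu> h \<Longrightarrow> dist_B \<mu> h \<le> frob_norm (P' - Q')"
    using dist_B_attained[of \<mu> h] by blast
  obtain R where R: "R \<in> Sigma_plus \<mu> h" "dist_set P (Sigma_plus \<mu> h) = frob_norm (P - R)"
    and min: "\<And>R'. R' \<in> Sigma_plus \<mu> h \<Longrightarrow> dist_set P (Sigma_plus \<mu> h) \<le> frob_norm (P - R')"
    using dist_set_attained[OF compact_SU5_orbit SU5_orbit_nonempty] by blast
  show ?thesis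
    using le[OF PQ(1) R(1)] R(2) min[OF PQ(2)] PQ(3) d[OF PQ(1)] by simp
qed

subsection \<open>The potential\<close>

text \<open>The vacuum value satisfies \<mu>^2 = (100/9) h v^2, so every term is a multiple of h v^4
  / 9.\<close>

lemma potential_scaled:
  assumes U: "U \<in> SU5" and "\<mu> > 0" "h > 0" and lam: "lam = - (10 / 9) * h" and V0: "V0 = 9 * \<mu> ^ 4 / (10 * h)"
  shows "potential \<mu> h lam V0 (adjoint_mat U ** real_diag (\<lambda>i. vev \<mu> h * x i) ** U) =
    h * vev \<mu> h ^ 4 / 9 *
      (1000 - 100 * (\<Sum>i\<in>UNIV. (x i)\<^sup>2) + 9 * (\<Sum>i\<in>UNIV. (x i)\<^sup>2)\<^sup>2 - 10 * (\<Sum>i\<in>UNIV. (x i)^4))"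
proof -
  let ?v = "vev \<mu> h"
  have "(sqrt h)\<^sup>2 = h" using \<open>h > 0\<close> by simp
  then have v2: "?v\<^sup>2 = 9 * \<mu>\<^sup>2 / (100 * h)"
    by (simp add: vev_def power_divide power_mult_distrib)
  then have \<mu>2: "\<mu>\<^sup>2 = 100 / 9 * h * ?v\<^sup>2"
    using \<open>h > 0\<close> by (simp add: field_simps)
  have "\<mu> ^ 4 = (\<mu>\<^sup>2)\<^sup>2" by simp
  also have "\<dots> = 10000 / 81 * h * (h * ?v ^ 4)"
    unfolding \<mu>2 by (simp add: power2_eq_square power4_eq_xxxx)
  finally have \<mu>4: "\<mu> ^ 4 = 10000 / 81 * h * (h * ?v ^ 4)" .
  have V0': "V0 = 1000 / 9 * h * ?v ^ 4"
    unfolding V0 \<mu>4 using \<open>h > 0\<close> by simp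
  have "(\<Sum>i\<in>UNIV. (?v * x i)\<^sup>2) = ?v\<^sup>2 * (\<Sum>i\<in>UNIV. (x i)\<^sup>2)"
    "(\<Sum>i\<in>UNIV. (?v * x i)^4) = ?v^4 * (\<Sum>i\<in>UNIV. (x i)^4)"
    by (simp_all add: power_mult_distrib sum_distrib_left)
  then show ?thesis
    unfolding potential_conj_real_diag[OF U] lam V0' \<mu>2
    by (simp add: power2_eq_square power4_eq_xxxx algebra_simps)
qed

lemma potential_segment:
  assumes "\<mu> > 0" "h > 0" "lam = - (10 / 9) * h" "V0 = 9 * \<mu> ^ 4 / (10 * h)"
  shows "potential \<mu> h lam V0 (s *\<^sub>R Phi_minus \<mu> h + (1 - s) *\<^sub>R Phi_plus \<mu> h)
    = h * vev \<mu> h ^ 4 / 9 * (6000 * s\<^sup>2 * (1 - s)\<^sup>2)"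
proof -
  let ?x = "\<lambda>i::5. if i = 5 then 3 * s - 4 else if i = 4 then 1 + 3 * s else 1 - 2 * s"
  have "s *\<^sub>R Phi_minus \<mu> h + (1 - s) *\<^sub>R Phi_plus \<mu> h = real_diag (\<lambda>i. vev \<mu> h * ?x i)"
    unfolding Phi_real_diag
    by (auto simp: vec_eq_iff real_diag_nth scaleR_conv_of_real[of _ "_::complex"] algebra_simps)
  then have "potential \<mu> h lam V0 (s *\<^sub>R Phi_minus \<mu> h + (1 - s) *\<^sub>R Phi_plus \<mu> h)
    = h * vev \<mu> h ^ 4 / 9 *
      (1000 - 100 * (\<Sum>i\<in>UNIV. (?x i)\<^sup>2) + 9 * (\<Sum>i\<in>UNIV. (?x i)\<^sup>2)\<^sup>2 - 10 * (\<Sum>i\<in>UNIV. (?x i)^4))"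
    using potential_scaled[OF mat_1_SU5 assms, of ?x] by simp
  also have "1000 - 100 * (\<Sum>i\<in>UNIV. (?x i)\<^sup>2) + 9 * (\<Sum>i\<in>UNIV. (?x i)\<^sup>2)\<^sup>2 - 10 * (\<Sum>i\<in>UNIV. (?x i)^4)
      = 6000 * s\<^sup>2 * (1 - s)\<^sup>2"
    by (simp add: sum_5) (simp add: power2_eq_square power4_eq_xxxx algebra_simps)
  finally show ?thesis .
qed

lemma potential_lower_bound:
  assumes par: "\<mu> > 0" "h > 0" "lam = - (10 / 9) * h" "V0 = 9 * \<mu> ^ 4 / (10 * h)"
    and Q: "Q \<in> herm0"
  defines "\<delta> \<equiv> dist_set Q (Sigma_plus \<mu> h)" and "d \<equiv> dist_B \<mu> h"
  shows "0 \<le> potential \<mu> h lam V0 Q"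
    and "\<delta> < d / 2 \<Longrightarrow>
      potential \<mu> h lam V0 ((\<delta> / d) *\<^sub>R Phi_minus \<mu> h + (1 - \<delta> / d) *\<^sub>R Phi_plus \<mu> h)
        \<le> potential \<mu> h lam V0 Q"
proof -
  define v where "v = vev \<mu> h"
  have v: "0 < v" using par by (simp add: v_def vev_def)
  \<comment> \<open>Weights least at index 5, so that the smallest eigenvalue lands there.\<close>
  define prio :: "5 \<Rightarrow> real" where "prio i = (vector [5, 4, 3, 2, 1] :: real^5) $ i" for i
  have "\<forall>i j. prio i = prio j \<longrightarrow> i = j"
    by (simp add: forall_5 prio_def vector_5)
  then have "inj prio" by (simp add: inj_def)
  then obtain U y where U: "U \<in> SU5" and Qy: "Q = adjoint_mat U ** real_diag y ** U"
    and ord: "\<And>i j. prio i < prio j \<Longrightarrow> y i \<le> y j"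
    using hermitian_diagonalize[of Q prio] Q unfolding herm0_def real_diag_def by blast
  define x where "x i = y i / v" for i
  have y: "y = (\<lambda>i. v * x i)" using v by (simp add: x_def)
  have UU: "U ** adjoint_mat U = mat 1" using U by (simp add: SU5_def)
  have "complex_of_real (sum y UNIV) = 0"
    using Q trace_conj[OF UU, of "real_diag y"] unfolding Qy by (simp add: herm0_def trace_real_diag)
  then have sumy: "sum y UNIV = 0" by (simp only: of_real_eq_0_iff)
  then have sumx: "sum x UNIV = 0" by (simp add: x_def flip: sum_divide_distrib)
  have min_y: "y 5 \<le> y i" for i
    using exhaust_5[of i] ord[of 5 i] by (auto simp: prio_def vector_5)
  then have min_x: "x 5 \<le> x i" for i
    using v by (simp add: x_def divide_right_mono)
  define t q where "t = (\<Sum>i\<in>UNIV. (x i)\<^sup>2)" and "q = (\<Sum>i\<in>UNIV. (x i)^4)"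
  have pot: "potential \<mu> h lam V0 Q = h * v ^ 4 / 9 * (1000 - 100 * t + 9 * t\<^sup>2 - 10 * q)"
    unfolding Qy y t_def q_def v_def by (rule potential_scaled[OF U par])
  note ineq = potential_ineq[of "x 1" "x 2" "x 3" "x 4" "x 5" t q,
    OF sumx[unfolded sum_5] min_x min_x min_x min_x t_def[unfolded sum_5] q_def[unfolded sum_5]]
  have pos: "0 \<le> h * v ^ 4 / 9" using par v by simp
  show "0 \<le> potential \<mu> h lam V0 Q"
    unfolding pot using pos ineq(1) by (rule mult_nonneg_nonneg)
  assume less: "\<delta> < d / 2"
  define s where "s = \<delta> / d"
  have d: "d = sqrt 30 * v" using v by (simp add: d_def v_def dist_B_eq)
  have \<delta>: "\<delta> = sqrt (v\<^sup>2 * (t + 20 + 10 * x 5))"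
  proof -
    have "\<delta> = sqrt ((\<Sum>i\<in>UNIV. (y i)\<^sup>2) + 20 * v\<^sup>2 + 10 * v * y 5)"
      unfolding \<delta>_def Qy v_def by (rule dist_set_Sigma_plus[OF U sumy min_y]) (use v in \<open>simp add: v_def\<close>)
    then show ?thesis
      by (simp add: y t_def power_mult_distrib sum_distrib_left power2_eq_square algebra_simps)
  qed
  \<comment> \<open>\<open>sqrt\<close> is negative on negative arguments; nonnegativity of \<delta>
    excludes this and allows squaring.\<close>
  obtain P where "\<delta> = frob_norm (Q - P)" "P \<in> Sigma_plus \<mu> h"
    unfolding \<delta>_def using dist_set_attained[OF compact_SU5_orbit SU5_orbit_nonempty] by blast
  then have "0 \<le> \<delta>"
    using Q SU5_orbit_herm[OF Phi_herm(1)] by (simp add: frob_norm_eq_norm adjoint_mat_diff herm0_def)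
  then have "\<delta>\<^sup>2 = v\<^sup>2 * (t + 20 + 10 * x 5)"
    unfolding \<delta> by simp
  then have "30 * s\<^sup>2 = t + 20 + 10 * x 5"
    using v by (simp add: s_def d power_divide power_mult_distrib)
  moreover have "0 \<le> s" "s \<le> 1/2"
    using \<open>0 \<le> \<delta>\<close> less v d by (simp_all add: s_def field_simps)
  ultimately have "6000 * s\<^sup>2 * (1 - s)\<^sup>2 \<le> 1000 - 100 * t + 9 * t\<^sup>2 - 10 * q"
    using ineq(2) by blast
  from mult_left_mono[OF this pos]
  show "potential \<mu> h lam V0 ((\<delta> / d) *\<^sub>R Phi_minus \<mu> h + (1 - \<delta> / d) *\<^sub>R Phi_plus \<mu> h)
      \<le> potential \<mu> h lam V0 Q"
    unfolding pot potential_segment[OF par] s_def v_def .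
qed

theorem proposition10:
  fixes \<mu> h lam V0 :: real and Q :: "complex^5^5"
  assumes "\<mu> > 0" and "h > 0"
    and "lam = - (10 / 9) * h"
    and "V0 = 9 * \<mu> ^ 4 / (10 * h)"
    and "Q \<in> herm0"
  shows "potential \<mu> h lam V0 Q \<ge> V_B \<mu> h lam V0 Q"
proof -
  note par = assms(1-4)
  have minus_Q: "- Q \<in> herm0"
    using assms(5) by (simp add: herm0_def adjoint_mat_def trace_def vec_eq_iff sum_negf)
  have dist_minus: "dist_set Q (Sigma_minus \<mu> h) = dist_set (- Q) (Sigma_plus \<mu> h)"
    by (simp add: Sigma_minus_eq dist_set_uminus)
  \<comment> \<open>The double well is invariant under s to 1 - s, so the bound for
    \<open>- Q\<close> near \<open>Sigma_plus\<close> covers \<open>Q\<close> near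
    \<open>Sigma_minus\<close>.\<close>
  have sym: "potential \<mu> h lam V0 (s *\<^sub>R Phi_plus \<mu> h + (1 - s) *\<^sub>R Phi_minus \<mu> h)
      = potential \<mu> h lam V0 (s *\<^sub>R Phi_minus \<mu> h + (1 - s) *\<^sub>R Phi_plus \<mu> h)" for s
    using potential_segment[OF par, of s] potential_segment[OF par, of "1 - s"]
    by (simp add: add.commute mult.commute mult.left_commute)
  show ?thesis
    using potential_lower_bound[OF par assms(5)] potential_lower_bound(2)[OF par minus_Q]
    by (simp add: V_B_def Let_def dist_minus sym potential_uminus)
qed

end
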